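(* Let $\Theta=(\Sigma,\varphi)$ be a connected $\mathbb{T}$-gain graph with a vertex ordering $<$, let $\xi:V(\Sigma)\to\mathbb{T}$ be a switching function, and suppose $D^{\max}_{<}(\Theta)=D^{\min}_{<}(\Theta)=:D(\Theta)$. Then $D^{\max}_{<}(\Theta^{\xi})=D^{\min}_{<}(\Theta^{\xi})=:D(\Theta^{\xi})$, and $D(\Theta)$ is similar to $D(\Theta^{\xi})$.
   Context: $\mathbb{T}=\{z\in\mathbb{C}:|z|=1\}$. A $\mathbb{T}$-gain graph $\Theta=(\Sigma,\varphi)$: simple finite graph $\Sigma$ with vertices $v_1,\dots,v_n$, $\varphi$ from oriented edges to $\mathbb{T}$ with $\varphi(\vec e_{k,j})=\varphi(\vec e_{j,k})^{-1}$; gain of an oriented path = product of its edge gains in order. $d$ is graph distance. For $y<z$, $\varphi^{\max}_{<}(y,z)$ (resp. $\varphi^{\min}_{<}(y,z)$) is the maximum (resp. minimum), in the lexicographic order on $\mathbb{C}$ (real part first, then imaginary part), of the gains of the shortest paths from $y$ to $z$; $\varphi^{\max}_{<}(z,y)=\overline{\varphi^{\max}_{<}(y,z)}$, likewise for min. $D^{\max}_{<}(\Theta)$ has $(s,t)$ entry $\varphi^{\max}_{<}(v_s,v_t)d(v_s,v_t)$ for $s\ne t$ and $0$ on the diagonal; $D^{\min}_{<}$ similarly. A switching function is $\xi:V(\Sigma)\to\mathbb{T}$, and $\Theta^{\xi}=(\Sigma,\varphi^{\xi})$ with $\varphi^{\xi}(\vec e_{j,k})=\xi(v_j)^{-1}\varphi(\vec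 e_{j,k})\xi(v_k)$. *)

theory Defs
  imports
    Complex_Main
    "Graph_Theory.Pair_Digraph"
    "Graph_Theory.Digraph_Component"
    "Graph_Theory.Shortest_Path"
    "Jordan_Normal_Form.Matrix"
begin

section \<open>The lexicographic order on the complex numbers\<close>

definition clex_less :: "complex \<Rightarrow> complex \<Rightarrow> bool" where
  "clex_less w z \<longleftrightarrow> Re w < Re z \<or> (Re w = Re z \<and> Im w < Im z)"

definition clex_le :: "complex \<Rightarrow> complex \<Rightarrow> bool" where
  "clex_le w z \<longleftrightarrow> Re w < Re z \<or> (Re w = Re z \<and> Im w \<le> Im z)"

global_interpretation clex: linorder clex_le clex_less
  defines clex_Max = clex.Max and clex_Min = clex.Min
  by unfold_locales (auto simp: clex_le_def clex_less_def complex_eq_iff)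

section \<open>Gain graphs over the unit circle\<close>

definition unit_circle :: "complex set" where
  "unit_circle = {z. cmod z = 1}"

text \<open>\<^locale>\<open>pair_graph\<close>: finite, loop-free, with a symmetric arc relation, so each undirected edge
  is present as its two orientations.\<close>

locale T_gain_graph = pair_graph G for G :: "'a pair_pre_digraph" +
  fixes \<phi> :: "'a \<times> 'a \<Rightarrow> complex"
  assumes gain_in_unit_circle: "e \<in> parcs G \<Longrightarrow> \<phi> e \<in> unit_circle"
    and gain_reverse: "(u, v) \<in> parcs G \<Longrightarrow> \<phi> (v, u) = inverse (\<phi> (u, v))"

definition path_gain :: "('a \<times> 'a \<Rightarrow> complex) \<Rightarrow> ('a \<times> 'a) awalk \<Rightarrow> complex" where
  "path_gain \<phi> p = prod_list (map \<phi> p)"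

text \<open>Graph distance is the infimum of walk costs for unit arc weights, finite on connected
  graphs. It is the least number of edges of a path: \<open>graph_dist_attained\<close> and
  \<open>graph_dist_le_length\<close> below.\<close>

definition graph_dist :: "'a pair_pre_digraph \<Rightarrow> 'a \<Rightarrow> 'a \<Rightarrow> real" where
  "graph_dist G u v = real_of_ereal (wf_digraph.\<mu> (with_proj G) (\<lambda>_. 1) u v)"

definition shortest_paths :: "'a pair_pre_digraph \<Rightarrow> 'a \<Rightarrow> 'a \<Rightarrow> ('a \<times> 'a) awalk set" where
  "shortest_paths G u v =
     {p. pre_digraph.apath (with_proj G) u p v \<and> real (length p) = graph_dist G u v}"

text \<open>The vertex ordering is a relation \<open>r\<close>; \<open>(y, z) \<in> r\<close> means \<open>y < z\<close>.
  The values at \<open>y = z\<close> are never used.\<close>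

definition gain_max ::
  "'a rel \<Rightarrow> 'a pair_pre_digraph \<Rightarrow> ('a \<times> 'a \<Rightarrow> complex) \<Rightarrow> 'a \<Rightarrow> 'a \<Rightarrow> complex" where
  "gain_max r G \<phi> y z =
     (if (y, z) \<in> r then clex_Max (path_gain \<phi> ` shortest_paths G y z)
      else cnj (clex_Max (path_gain \<phi> ` shortest_paths G z y)))"

definition gain_min ::
  "'a rel \<Rightarrow> 'a pair_pre_digraph \<Rightarrow> ('a \<times> 'a \<Rightarrow> complex) \<Rightarrow> 'a \<Rightarrow> 'a \<Rightarrow> complex" where
  "gain_min r G \<phi> y z =
     (if (y, z) \<in> r then clex_Min (path_gain \<phi> ` shortest_paths G y z)
      else cnj (clex_Min (path_gain \<phi> ` shortest_paths G z y)))"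

text \<open>The list \<open>vs\<close> enumerates the vertices and fixes the indexing of rows and columns;
  it is independent of the vertex ordering \<open>r\<close>.\<close>

definition gain_dist_max ::
  "'a rel \<Rightarrow> 'a list \<Rightarrow> 'a pair_pre_digraph \<Rightarrow> ('a \<times> 'a \<Rightarrow> complex) \<Rightarrow> complex mat" where
  "gain_dist_max r vs G \<phi> = mat (length vs) (length vs) (\<lambda>(s, t).
     if s = t then 0
     else gain_max r G \<phi> (vs ! s) (vs ! t) * of_real (graph_dist G (vs ! s) (vs ! t)))"

definition gain_dist_min ::
  "'a rel \<Rightarrow> 'a list \<Rightarrow> 'a pair_pre_digraph \<Rightarrow> ('a \<times> 'a \<Rightarrow> complex) \<Rightarrow> complex mat" where
  "gain_dist_min r vs G \<phi> = mat (length vs) (length vs) (\<lambda>(s, t).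
     if s = t then 0
     else gain_min r G \<phi> (vs ! s) (vs ! t) * of_real (graph_dist G (vs ! s) (vs ! t)))"

definition switch :: "('a \<Rightarrow> complex) \<Rightarrow> ('a \<times> 'a \<Rightarrow> complex) \<Rightarrow> 'a \<times> 'a \<Rightarrow> complex" where
  "switch \<xi> \<phi> = (\<lambda>(u, v). inverse (\<xi> u) * \<phi> (u, v) * \<xi> v)"

section \<open>Well-definedness\<close>

lemma T_gain_graph_switch:
  assumes "T_gain_graph G \<phi>" and "\<And>v. v \<in> pverts G \<Longrightarrow> \<xi> v \<in> unit_circle"
  shows "T_gain_graph G (switch \<xi> \<phi>)"
proof -
  interpret T_gain_graph G \<phi> by fact
  show ?thesis
  proof unfold_locales
    fix e assume e: "e \<in> parcs G"
    then have "fst e \<in> pverts G" "snd e \<in> pverts G"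
      by (auto intro: arc_fst_in_verts arc_snd_in_verts)
    then show "switch \<xi> \<phi> e \<in> unit_circle"
      using gain_in_unit_circle[OF e] assms(2)
      by (cases e) (auto simp: switch_def unit_circle_def norm_mult norm_inverse)
  next
    fix u v assume "(u, v) \<in> parcs G"
    then show "switch \<xi> \<phi> (v, u) = inverse (switch \<xi> \<phi> (u, v))"
      using gain_reverse[of u v] by (simp add: switch_def mult.commute mult.left_commute)
  qed
qed

lemma (in pair_graph) reachable_if_connected:
  assumes "Digraph_Component.connected (with_proj G)" "u \<in> pverts G" "v \<in> pverts G"
  shows "u \<rightarrow>\<^sup>*\<^bsub>with_proj G\<^esub> v"
  using symmetric_connected_imp_strongly_connected[OF sym_arcs assms(1)] assms(2,3)
  by (auto simp: strongly_connected_def)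

lemma (in pair_graph) graph_dist_attained:
  assumes "Digraph_Component.connected (with_proj G)" "u \<in> pverts G" "v \<in> pverts G"
  shows "\<exists>p. apath u p v \<and> real (length p) = graph_dist G u v"
proof -
  have len: "awalk_cost (\<lambda>_. 1) p = real (length p)" for p :: "('a \<times> 'a) awalk"
    by (induct p) auto
  from no_neg_cyc_reach_imp_path[OF reachable_if_connected[OF assms], of "\<lambda>_. 1"]
  obtain p where "apath u p v" "\<mu> (\<lambda>_. 1) u v = ereal (awalk_cost (\<lambda>_. 1) p)"
    by (auto simp: len)
  then show ?thesis by (auto simp: graph_dist_def len)
qed

lemma (in pair_graph) graph_dist_le_length:
  assumes "Digraph_Component.connected (with_proj G)" "awalk u p v"
  shows "graph_dist G u v \<le> real (length p)"
proof -
  have len: "awalk_cost (\<lambda>_. 1) p = real (length p)" for p :: "('a \<times> 'a) awalk"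
    by (induct p) auto
  have "u \<in> pverts G" "v \<in> pverts G" using assms(2) by auto
  from no_neg_cyc_reach_imp_path[OF reachable_if_connected[OF assms(1) this], of "\<lambda>_. 1"]
  obtain q where "\<mu> (\<lambda>_. 1) u v = ereal (awalk_cost (\<lambda>_. 1) q)"
    by (auto simp: len)
  with min_cost_le_walk_cost[OF assms(2), of "\<lambda>_. 1"] show ?thesis
    by (simp add: graph_dist_def len)
qed

lemma (in pair_graph) shortest_paths_nonempty:
  assumes "Digraph_Component.connected (with_proj G)" "u \<in> pverts G" "v \<in> pverts G"
  shows "shortest_paths G u v \<noteq> {}"
  using graph_dist_attained[OF assms] by (auto simp: shortest_paths_def)

lemma (in pair_graph) finite_shortest_paths: "finite (shortest_paths G u v)"
  by (rule finite_subset[OF _ apaths_finite[of u v]]) (auto simp: shortest_paths_def)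

end

theory Submission
  imports Defs
begin

text \<open>Switching multiplies the gain of every walk from \<open>u\<close> to \<open>v\<close> by the same factor
  \<open>inverse (\<xi> u) * \<xi> v\<close>. If the maximum and the minimum of the gains of the shortest
  paths agree, then all these gains agree; this property survives switching, and the distance
  matrix is conjugated by the diagonal matrix of \<open>\<xi>\<close>. Equality of extrema is essential, because
  multiplication by a unit complex number does not respect the lexicographic order.\<close>

lemma unit_circle_nonzero:
  "z \<in> unit_circle \<Longrightarrow> z \<noteq> 0"
  by (auto simp: unit_circle_def)

lemma cnj_eq_inverse_if_unit_circle:
  "z \<in> unit_circle \<Longrightarrow> cnj z = inverse z"
  by (simp add: unit_circle_def inverse_complex_def complex_eq_iff cmod_def)

text \<open>The product telescopes: at each interior vertex \<open>w\<close> the factor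
  \<open>\<xi> w\<close> of the incoming arc cancels \<open>inverse (\<xi> w)\<close> of the
  outgoing one, so only the endpoints contribute.\<close>

lemma (in pair_wf_digraph) path_gain_switch:
  assumes "awalk u p v" and nz: "\<And>w. w \<in> pverts G \<Longrightarrow> \<xi> w \<noteq> 0"
  shows "path_gain (switch \<xi> \<phi>) p = inverse (\<xi> u) * path_gain \<phi> p * \<xi> v"
  using assms(1)
proof (induction p arbitrary: u)
  case Nil
  then show ?case using nz[of v] by (auto simp: path_gain_def awalk_Nil_iff)
next
  case (Cons e p)
  obtain x y where e: "e = (x, y)" by (cases e)
  from Cons.prems have "x = u" and w: "awalk y p v"
    by (auto simp: awalk_Cons_iff e)
  moreover have "\<xi> y \<noteq> 0" using nz[of y] w by auto
  ultimately show ?case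
    using Cons.IH[OF w] by (simp add: e path_gain_def switch_def)
qed

text \<open>Every element lies between the minimum and the maximum, so antisymmetry of the order
  applies.\<close>

lemma eq_singleton_if_clex_Max_eq_Min:
  assumes "finite S" "S \<noteq> {}" "clex_Max S = clex_Min S"
  shows "S = {clex_Max S}"
proof -
  have "x = clex_Max S" if "x \<in> S" for x
    using that assms clex.Max_ge[of S x] clex.Min_le[of S x] clex.order.antisym by auto
  then show ?thesis using assms(2) by blast
qed

text \<open>\<open>shortest_paths\<close> does not depend on the gains, so switching only multiplies
  the one common gain by a constant, and the set of gains remains a singleton.\<close>

lemma (in pair_graph) path_gain_extrema_switch:
  assumes "Digraph_Component.connected (with_proj G)" "u \<in> pverts G" "v \<in> pverts G"
    and nz: "\<And>w. w \<in> pverts G \<Longrightarrow> \<xi> w \<noteq> 0"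
    and eq: "clex_Max (path_gain \<phi> ` shortest_paths G u v)
      = clex_Min (path_gain \<phi> ` shortest_paths G u v)"
  defines "c \<equiv> inverse (\<xi> u) * clex_Max (path_gain \<phi> ` shortest_paths G u v) * \<xi> v"
  shows "clex_Max (path_gain (switch \<xi> \<phi>) ` shortest_paths G u v) = c"
    and "clex_Min (path_gain (switch \<xi> \<phi>) ` shortest_paths G u v) = c"
proof -
  let ?g = "clex_Max (path_gain \<phi> ` shortest_paths G u v)"
  have ne: "shortest_paths G u v \<noteq> {}"
    by (rule shortest_paths_nonempty) fact+
  have single: "path_gain \<phi> ` shortest_paths G u v = {?g}"
    by (rule eq_singleton_if_clex_Max_eq_Min) (use ne eq finite_shortest_paths in auto)
  have "path_gain (switch \<xi> \<phi>) p = c" if p: "p \<in> shortest_paths G u v" for p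
  proof -
    have "path_gain \<phi> p = ?g" using single p by blast
    moreover have "awalk u p v" using p by (simp add: shortest_paths_def apath_def)
    ultimately show ?thesis by (simp add: path_gain_switch nz c_def)
  qed
  with ne have "path_gain (switch \<xi> \<phi>) ` shortest_paths G u v = {c}" by force
  then show "clex_Max (path_gain (switch \<xi> \<phi>) ` shortest_paths G u v) = c"
    and "clex_Min (path_gain (switch \<xi> \<phi>) ` shortest_paths G u v) = c" by simp_all
qed

text \<open>If \<open>(u, v)\<close> is not in \<open>r\<close>, the values are conjugates of
  extrema over the paths from \<open>v\<close> to \<open>u\<close>. On the unit circle
  \<open>cnj\<close> is inversion, so conjugating the factor
  \<open>inverse (\<xi> v) * \<xi> u\<close> gives the factor for \<open>u\<close> to
  \<open>v\<close>.\<close>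

lemma (in pair_graph) gain_extrema_switch:
  assumes "Digraph_Component.connected (with_proj G)" "u \<in> pverts G" "v \<in> pverts G"
    and \<xi>: "\<And>w. w \<in> pverts G \<Longrightarrow> \<xi> w \<in> unit_circle"
    and eq: "gain_max r G \<phi> u v = gain_min r G \<phi> u v"
  shows "gain_max r G (switch \<xi> \<phi>) u v = inverse (\<xi> u) * gain_max r G \<phi> u v * \<xi> v"
    and "gain_min r G (switch \<xi> \<phi>) u v = inverse (\<xi> u) * gain_max r G \<phi> u v * \<xi> v"
proof -
  note nz = unit_circle_nonzero[OF \<xi>]
  note cnj_\<xi> = cnj_eq_inverse_if_unit_circle[OF \<xi>]
  show "gain_max r G (switch \<xi> \<phi>) u v = inverse (\<xi> u) * gain_max r G \<phi> u v * \<xi> v"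
    and "gain_min r G (switch \<xi> \<phi>) u v = inverse (\<xi> u) * gain_max r G \<phi> u v * \<xi> v"
    using assms(1-3) eq cnj_\<xi>[of u] cnj_\<xi>[of v]
      path_gain_extrema_switch[of u v \<xi> \<phi>, OF _ _ _ nz]
      path_gain_extrema_switch[of v u \<xi> \<phi>, OF _ _ _ nz]
    by (auto simp: gain_max_def gain_min_def)
qed

text \<open>This allows the distance to be cancelled from off-diagonal matrix entries, which
  recovers the gains.\<close>

lemma (in pair_graph) graph_dist_nonzero:
  assumes "Digraph_Component.connected (with_proj G)" "u \<in> pverts G" "v \<in> pverts G" "u \<noteq> v"
  shows "graph_dist G u v \<noteq> 0"
proof
  assume "graph_dist G u v = 0"
  with graph_dist_attained[OF assms(1-3)] have "apath u [] v" by auto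
  with assms(4) show False by (simp add: apath_def awalk_Nil_iff)
qed

text \<open>The entrywise relation says that \<open>B\<close> is the conjugate of \<open>A\<close>
  by the invertible diagonal matrix with entries \<open>d i\<close>.\<close>

lemma similar_mat_diag_conjugate:
  fixes A B :: "'a :: field mat"
  assumes "A \<in> carrier_mat n n" "B \<in> carrier_mat n n"
    and nz: "\<And>i. i < n \<Longrightarrow> d i \<noteq> 0"
    and B: "\<And>i j. i < n \<Longrightarrow> j < n \<Longrightarrow> B $$ (i, j) = inverse (d i) * A $$ (i, j) * d j"
  shows "similar_mat A B"
proof -
  let ?P = "mat_diag n d" and ?Q = "mat_diag n (\<lambda>i. inverse (d i))"
  have "?P * ?Q = 1\<^sub>m n" "?Q * ?P = 1\<^sub>m n"
    using nz unfolding mat_diag_diag by (auto intro!: eq_matI simp: mat_diag_def)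
  moreover have "A = ?P * B * ?Q"
    using assms(1,2) nz
    by (intro eq_matI)
      (auto simp: mat_diag_mult_left[OF assms(2)] mat_diag_mult_right[of _ n n] B)
  ultimately show ?thesis
    using assms(1,2) by (intro similar_matI[of A B ?P ?Q n]) simp_all
qed

theorem theorem12:
  fixes G :: "'a pair_pre_digraph" and \<phi> :: "'a \<times> 'a \<Rightarrow> complex"
    and r :: "'a rel" and vs :: "'a list" and \<xi> :: "'a \<Rightarrow> complex"
  assumes "T_gain_graph G \<phi>"
    and "Digraph_Component.connected (with_proj G)"
    and "distinct vs" and "set vs = pverts G"
    and "strict_linear_order_on (pverts G) r"
    and "\<And>v. v \<in> pverts G \<Longrightarrow> \<xi> v \<in> unit_circle"
    and "gain_dist_max r vs G \<phi> = gain_dist_min r vs G \<phi>"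
  shows "gain_dist_max r vs G (switch \<xi> \<phi>) = gain_dist_min r vs G (switch \<xi> \<phi>)
    \<and> similar_mat (gain_dist_max r vs G \<phi>) (gain_dist_max r vs G (switch \<xi> \<phi>))"
proof -
  interpret T_gain_graph G \<phi> by fact
  let ?n = "length vs"
  have vert: "vs ! s \<in> pverts G" if "s < ?n" for s
    using that assms(4) nth_mem by blast
  \<comment> \<open>Only off-diagonal entries carry information: both matrices are 0 on the diagonal
    whatever the gains.\<close>
  have eq: "gain_max r G \<phi> (vs ! s) (vs ! t) = gain_min r G \<phi> (vs ! s) (vs ! t)"
    if st: "s < ?n" "t < ?n" "s \<noteq> t" for s t
  proof -
    have "graph_dist G (vs ! s) (vs ! t) \<noteq> 0"
      using graph_dist_nonzero assms(2,3) vert st by (simp add: nth_eq_iff_index_eq)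
    moreover have "gain_dist_max r vs G \<phi> $$ (s, t) = gain_dist_min r vs G \<phi> $$ (s, t)"
      by (simp only: assms(7))
    ultimately show ?thesis
      using st by (simp add: gain_dist_max_def gain_dist_min_def)
  qed
  note extrema = gain_extrema_switch[OF assms(2) vert vert assms(6) eq]
  have "gain_dist_max r vs G (switch \<xi> \<phi>) = gain_dist_min r vs G (switch \<xi> \<phi>)"
    unfolding gain_dist_max_def gain_dist_min_def by (intro cong_mat) (auto simp: extrema)
  moreover have "similar_mat (gain_dist_max r vs G \<phi>) (gain_dist_max r vs G (switch \<xi> \<phi>))"
    \<comment> \<open>The diagonal matrix lists the values of \<open>\<xi>\<close> in the order of
      \<open>vs\<close>. Distances are unaffected by switching, and on the diagonal the relation
      reads 0 = 0.\<close>
    by (rule similar_mat_diag_conjugate[where n = ?n and d = "\<lambda>s. \<xi> (vs ! s)"])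
      (use assms(6) vert in \<open>auto simp: gain_dist_max_def extrema unit_circle_nonzero\<close>)
  ultimately show ?thesis ..
qed

end
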